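(* Let $\mathcal{I}$ be any set-theoretic ideal on $\mathbb{Z}$ (a nonempty family of subsets of $\mathbb{Z}$ closed under subsets and finite unions). Let $E \subseteq \mathbb{Z}$ be such that, for every $M \in \mathbb{N}$ and every Presburger-definable function $h : \mathbb{Z}^M \to \mathbb{Z}$, the image $h(E^M)$ lies in $\mathcal{I}$. Then every subset of $\mathbb{Z}$ definable in $(\mathbb{Z}, <, +, E)^\#$ either contains arbitrarily long pieces of some arithmetic progression or lies in $\mathcal{I}$.
   Context: $\mathbb{N}$ denotes the nonnegative integers. A set or function is Presburger-definable if it (respectively its graph) is first-order definable in $(\mathbb{Z}, <, +)$. The structure $(\mathbb{Z}, <, +, E)^\#$ is the expansion $(\mathbb{Z}, <, +, (S))$ of $(\mathbb{Z},<,+)$ by a predicate for every set $S$ ranging over all subsets of $E^k$, for all $k \in \mathbb{N}$. A set $S \subseteq \mathbb{Z}$ contains arbitrarily long pieces of some arithmetic progression if there exists $N \in \mathbb{Z}_{>0}$ such that for every $\ell \in \mathbb{Z}_{>0}$ there exists $a \in \mathbb{Z}$ with $a, a+N, \dots, a+(\ell-1)N$ all in $S$. *)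

theory Defs
  imports Main
begin

text \<open>
  First-order logic over expansions of \<open>(\<int>, <, +)\<close> by predicates. A predicate symbol is a pair
  \<open>(k, S)\<close> of an arity and a set of \<open>k\<close>-tuples, and denotes \<open>S\<close>. Tuples are lists; the arity is part
  of the symbol because the empty set is a relation of every arity.
\<close>

datatype tm = Var nat | Plus tm tm

datatype fm =
    Equal tm tm
  | Less tm tm
  | Pred nat "int list set" "tm list"
  | Neg fm
  | Conj fm fm
  | Exi nat fm

primrec tm_val :: "(nat \<Rightarrow> int) \<Rightarrow> tm \<Rightarrow> int" where
  "tm_val e (Var n) = e n"
| "tm_val e (Plus s t) = tm_val e s + tm_val e t"

primrec sat :: "(nat \<Rightarrow> int) \<Rightarrow> fm \<Rightarrow> bool" where
  "sat e (Equal s t) \<longleftrightarrow> tm_val e s = tm_val e t"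
| "sat e (Less s t) \<longleftrightarrow> tm_val e s < tm_val e t"
| "sat e (Pred k S ts) \<longleftrightarrow> map (tm_val e) ts \<in> S"
| "sat e (Neg p) \<longleftrightarrow> \<not> sat e p"
| "sat e (Conj p q) \<longleftrightarrow> sat e p \<and> sat e q"
| "sat e (Exi n p) \<longleftrightarrow> (\<exists>x. sat (e(n := x)) p)"

primrec in_language :: "(nat \<times> int list set) set \<Rightarrow> fm \<Rightarrow> bool" where
  "in_language L (Equal s t) \<longleftrightarrow> True"
| "in_language L (Less s t) \<longleftrightarrow> True"
| "in_language L (Pred k S ts) \<longleftrightarrow> (k, S) \<in> L \<and> length ts = k"
| "in_language L (Neg p) \<longleftrightarrow> in_language L p"
| "in_language L (Conj p q) \<longleftrightarrow> in_language L p \<and> in_language L q"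
| "in_language L (Exi n p) \<longleftrightarrow> in_language L p"

definition tuples :: "'a set \<Rightarrow> nat \<Rightarrow> 'a list set" where
  "tuples A k = {xs. length xs = k \<and> set xs \<subseteq> A}"

text \<open>
  Definability of a set of \<open>k\<close>-tuples in the expansion of \<open>(\<int>, <, +)\<close> by the predicates in \<open>L\<close>. The
  variables with index below \<open>k\<close> hold the tuple; every other free variable \<open>i\<close> of the formula stands
  for the parameter \<open>c i\<close>. Since each integer is definable without parameters in \<open>(\<int>, <, +)\<close>,
  parameters do not enlarge the class of definable sets.
\<close>

definition definable :: "(nat \<times> int list set) set \<Rightarrow> nat \<Rightarrow> int list set \<Rightarrow> bool" where
  "definable L k X \<longleftrightarrow>
     (\<exists>p c. in_language L p \<and>
        X = {xs \<in> tuples UNIV k. sat (\<lambda>i. if i < k then xs ! i else c i) p})"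

text \<open>A function \<open>\<int>\<^sup>M \<rightarrow> \<int>\<close> is given by the values of \<open>h\<close> on lists of length \<open>M\<close>.\<close>

definition presburger_definable_fun :: "nat \<Rightarrow> (int list \<Rightarrow> int) \<Rightarrow> bool" where
  "presburger_definable_fun M h \<longleftrightarrow>
     definable {} (Suc M) {xs @ [h xs] | xs. xs \<in> tuples UNIV M}"

definition sharp :: "int set \<Rightarrow> (nat \<times> int list set) set" where
  "sharp E = {(k, S). S \<subseteq> tuples E k}"

definition definable_in_sharp :: "int set \<Rightarrow> int set \<Rightarrow> bool" where
  "definable_in_sharp E X \<longleftrightarrow> definable (sharp E) 1 ((\<lambda>x. [x]) ` X)"

definition set_ideal :: "'a set set \<Rightarrow> bool" where
  "set_ideal \<I> \<longleftrightarrow> \<I> \<noteq> {} \<and>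
     (\<forall>A\<in>\<I>. \<forall>B. B \<subseteq> A \<longrightarrow> B \<in> \<I>) \<and>
     (\<forall>A\<in>\<I>. \<forall>B\<in>\<I>. A \<union> B \<in> \<I>)"

definition contains_long_AP_pieces :: "int set \<Rightarrow> bool" where
  "contains_long_AP_pieces S \<longleftrightarrow>
     (\<exists>N>0. \<forall>l::nat. l > 0 \<longrightarrow> (\<exists>a. \<forall>i<l. a + int i * N \<in> S))"

end

theory Submission
  imports Defs
begin

text \<open>
  Call two tuples similar if they are congruent modulo \<open>q\<close> and integer linear forms with coefficients
  of absolute value at most \<open>k\<close> place them on the same side of every sum of at most \<open>k\<close> elements of
  \<open>E \<union> -E \<union> {1, -1}\<close>. Every set definable in the expansion is a union of similarity classes for some
  \<open>q\<close> and \<open>k\<close>: a back-and-forth argument handles quantifiers, the point being that a nonempty set of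
  thresholds bounded above has a maximum, so that a cut among thresholds has a definite edge from
  which residues can be counted. No definability is needed on \<open>E\<close>, as all relations on \<open>E\<close> are allowed.

  For a definable \<open>X \<subseteq> \<int>\<close>, the points within bounded distance of a threshold form a member of the
  ideal. If \<open>X\<close> is not in the ideal, it has points arbitrarily far from all thresholds, and the
  similarity class of such a point contains a long progression with difference \<open>q\<close>.
\<close>

section \<open>Similar tuples\<close>

definition lin :: "nat \<Rightarrow> (nat \<Rightarrow> int) \<Rightarrow> (nat \<Rightarrow> int) \<Rightarrow> int" where
  "lin n a e = (\<Sum>j<n. a j * e j)"

text \<open>Including 1 and -1 makes small integers thresholds and lets a threshold be shifted by
  one, which turns weak inequalities into strict ones. Including the negatives of elements of
  \<open>E\<close> makes the family closed under negation.\<close>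

definition signed_sums :: "int set \<Rightarrow> nat \<Rightarrow> int set" where
  "signed_sums E k =
     {sum_list us | us. length us \<le> k \<and> set us \<subseteq> E \<union> uminus ` E \<union> {1, -1}}"

text \<open>Strict comparisons are enough: \<open>lin n a e = v\<close> is read off from the cuts at
  \<open>v\<close> and \<open>v + 1\<close>, so an equality costs one more summand.\<close>

definition similar :: "int set \<Rightarrow> nat \<Rightarrow> int \<Rightarrow> nat \<Rightarrow> (nat \<Rightarrow> int) \<Rightarrow> (nat \<Rightarrow> int) \<Rightarrow> bool" where
  "similar E n q k e e' \<longleftrightarrow>
     (\<forall>j<n. q dvd e j - e' j) \<and>
     (\<forall>a v. (\<forall>j<n. \<bar>a j\<bar> \<le> int k) \<longrightarrow> v \<in> signed_sums E k \<longrightarrow>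
        (lin n a e < v \<longleftrightarrow> lin n a e' < v))"

section \<open>Linear forms\<close>

lemma lin_add: "lin n (\<lambda>j. a j + b j) e = lin n a e + lin n b e"
  by (simp add: lin_def sum.distrib distrib_right)

lemma lin_diff: "lin n (\<lambda>j. a j - b j) e = lin n a e - lin n b e"
  by (simp add: lin_def sum_subtractf left_diff_distrib)

lemma lin_scale: "lin n (\<lambda>j. c * a j) e = c * lin n a e"
  by (simp add: lin_def sum_distrib_left mult.assoc)

lemma lin_fun_upd:
  assumes "i < n"
  shows "lin n a (e(i := x)) = a i * x + lin n (a(i := 0)) e"
proof -
  have "lin n a (e(i := x)) = a i * x + (\<Sum>j\<in>{..<n} - {i}. a j * (e(i := x)) j)"
    unfolding lin_def using assms by (subst sum.remove[of _ i]) auto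
  also have "(\<Sum>j\<in>{..<n} - {i}. a j * (e(i := x)) j) = (\<Sum>j\<in>{..<n} - {i}. (a(i := 0)) j * e j)"
    by (rule sum.cong) auto
  also have "\<dots> = lin n (a(i := 0)) e"
    unfolding lin_def using assms by (subst (2) sum.remove[of _ i]) auto
  finally show ?thesis .
qed

lemma dvd_lin_diff:
  assumes "\<And>j. j < n \<Longrightarrow> q dvd e j - e' j"
  shows "q dvd lin n a e - lin n a e'"
proof -
  have "lin n a e - lin n a e' = (\<Sum>j<n. a j * (e j - e' j))"
    by (simp add: lin_def sum_subtractf right_diff_distrib)
  then show ?thesis
    using assms by (auto intro!: dvd_sum dvd_mult)
qed

lemma abs_lin_le:
  assumes "\<And>j. j < n \<Longrightarrow> \<bar>a j\<bar> \<le> K"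
  shows "\<bar>lin n a e\<bar> \<le> K * (\<Sum>j<n. \<bar>e j\<bar>)"
proof -
  have "\<bar>lin n a e\<bar> \<le> (\<Sum>j<n. \<bar>a j * e j\<bar>)"
    unfolding lin_def by (rule sum_abs)
  also have "\<dots> \<le> (\<Sum>j<n. K * \<bar>e j\<bar>)"
    using assms by (intro sum_mono) (auto simp: abs_mult intro!: mult_right_mono)
  finally show ?thesis
    by (simp add: sum_distrib_left)
qed

section \<open>Arithmetic of thresholds\<close>

lemma signed_sums_mono: "j \<le> k \<Longrightarrow> signed_sums E j \<subseteq> signed_sums E k"
  unfolding signed_sums_def by fastforce

lemma signed_sums_add:
  assumes "v \<in> signed_sums E j" "w \<in> signed_sums E k"
  shows "v + w \<in> signed_sums E (j + k)"
proof -
  obtain us ws where "v = sum_list us" "length us \<le> j" "set us \<subseteq> E \<union> uminus ` E \<union> {1, -1}"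
    "w = sum_list ws" "length ws \<le> k" "set ws \<subseteq> E \<union> uminus ` E \<union> {1, -1}"
    using assms unfolding signed_sums_def by blast
  then have "v + w = sum_list (us @ ws) \<and> length (us @ ws) \<le> j + k
      \<and> set (us @ ws) \<subseteq> E \<union> uminus ` E \<union> {1, -1}"
    by simp
  then show ?thesis
    unfolding signed_sums_def by blast
qed

lemma signed_sums_uminus:
  assumes "v \<in> signed_sums E k"
  shows "- v \<in> signed_sums E k"
proof -
  obtain us where "v = sum_list us" "length us \<le> k" "set us \<subseteq> E \<union> uminus ` E \<union> {1, -1}"
    using assms unfolding signed_sums_def by blast
  then have "- v = sum_list (map uminus us) \<and> length (map uminus us) \<le> k
      \<and> set (map uminus us) \<subseteq> E \<union> uminus ` E \<union> {1, -1}"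
    using uminus_sum_list_map[of id us] by (auto simp: o_def)
  then show ?thesis
    unfolding signed_sums_def by blast
qed

lemma zero_in_signed_sums: "0 \<in> signed_sums E k"
  unfolding signed_sums_def by (auto intro!: exI[of _ "[]"])

lemma signed_sums_1I: "w \<in> E \<union> uminus ` E \<union> {1, -1} \<Longrightarrow> w \<in> signed_sums E 1"
  unfolding signed_sums_def by (auto intro!: exI[of _ "[w]"])

lemma signed_sums_scale_nat: "v \<in> signed_sums E k \<Longrightarrow> int c * v \<in> signed_sums E (c * k)"
proof (induction c)
  case 0
  then show ?case by (simp add: zero_in_signed_sums)
next
  case (Suc c)
  then show ?case
    using signed_sums_add[of v E k "int c * v" "c * k"] by (simp add: algebra_simps)
qed

lemma nat_in_signed_sums: "int c \<in> signed_sums E c"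
  using signed_sums_scale_nat[OF signed_sums_1I[of 1 E], of c] by simp

lemma signed_sums_Suc:
  assumes "v \<in> signed_sums E (Suc k)"
  obtains "v \<in> signed_sums E k"
    | w v' where "w \<in> E \<union> uminus ` E \<union> {1, -1}" "v' \<in> signed_sums E k" "v = v' + w"
proof -
  obtain us where us: "v = sum_list us" "length us \<le> Suc k" "set us \<subseteq> E \<union> uminus ` E \<union> {1, -1}"
    using assms unfolding signed_sums_def by blast
  show thesis
  proof (cases us)
    case Nil
    then show ?thesis using us that(1) zero_in_signed_sums by simp
  next
    case (Cons w ws)
    then have "sum_list ws \<in> signed_sums E k"
      using us unfolding signed_sums_def by auto
    then show ?thesis using us Cons that(2)[of w "sum_list ws"] by auto
  qed
qed

lemma similar_sym: "similar E n q k e e' \<Longrightarrow> similar E n q k e' e"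
  unfolding similar_def by (auto simp: dvd_diff_commute)

lemma similar_mono:
  assumes "similar E n q' k' e e'" "q dvd q'" "k \<le> k'"
  shows "similar E n q k e e'"
proof -
  have "lin n a e < v \<longleftrightarrow> lin n a e' < v"
    if "\<forall>j<n. \<bar>a j\<bar> \<le> int k" "v \<in> signed_sums E k" for a v
  proof -
    have "\<forall>j<n. \<bar>a j\<bar> \<le> int k'"
      using that(1) assms(3) by fastforce
    moreover have "v \<in> signed_sums E k'"
      using that(2) assms(3) signed_sums_mono by blast
    ultimately show ?thesis
      using assms(1) unfolding similar_def by blast
  qed
  moreover have "\<forall>j<n. q dvd e j - e' j"
    using assms(1,2) dvd_trans unfolding similar_def by blast
  ultimately show ?thesis
    unfolding similar_def by blast
qed

section \<open>Quantifiers\<close>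

text \<open>The point \<open>z'\<close> is placed relative to one threshold. If some threshold is at
  most \<open>z\<close>, there is a largest such one, even for infinite \<open>T\<close>, and
  \<open>z'\<close> goes a small distance above its counterpart; otherwise there is a smallest
  threshold, and \<open>z'\<close> goes below its counterpart. At \<open>r = 0\<close>,
  \<open>gaps\<close> says that \<open>f\<close> and \<open>f'\<close> order the thresholds
  alike.\<close>

lemma transfer_cut:
  fixes f f' :: "'a \<Rightarrow> int"
  assumes "Q > 0" "T \<noteq> {}"
    and cong: "\<And>s. s \<in> T \<Longrightarrow> Q dvd f s - f' s"
    and gaps: "\<And>s t r. s \<in> T \<Longrightarrow> t \<in> T \<Longrightarrow> 0 \<le> r \<Longrightarrow> r \<le> Q \<Longrightarrow>
      f t - f s \<le> r \<longleftrightarrow> f' t - f' s \<le> r"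
  obtains z' where "Q dvd z - z'" "\<And>s. s \<in> T \<Longrightarrow> z < f s \<longleftrightarrow> z' < f' s"
proof (cases "\<exists>s\<in>T. f s \<le> z")
  case True
  then obtain s0 where s0: "s0 \<in> T" "f s0 \<le> z"
    and min0: "\<And>s. s \<in> T \<Longrightarrow> f s \<le> z \<Longrightarrow> nat (z - f s0) \<le> nat (z - f s)"
    using ex_has_least_nat[of "\<lambda>s. s \<in> T \<and> f s \<le> z" _ "\<lambda>s. nat (z - f s)"] by blast
  have max0: "f s \<le> f s0" if "s \<in> T" "f s \<le> z" for s
    using min0[OF that] that s0 by linarith
  \<comment> \<open>The distance \<open>z - f s0\<close> may be arbitrarily large, while
    \<open>gaps\<close> controls distances up to \<open>Q\<close> only. Its remainder is in that
    range and keeps the residue class. A threshold above \<open>z\<close> exceeds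
    \<open>f s0\<close> by more than \<open>r\<close>, so its counterpart stays above
    \<open>z'\<close>.\<close>
  define r where "r = (z - f s0) mod Q"
  have r: "0 \<le> r" "r \<le> Q" "r \<le> z - f s0"
    using \<open>Q > 0\<close> s0 unfolding r_def
    by (auto simp: zmod_le_nonneg_dividend pos_mod_bound less_imp_le)
  have "Q dvd (z - f s0) - r"
    unfolding r_def by (simp add: dvd_minus_mod)
  then have "Q dvd ((z - f s0) - r) + (f s0 - f' s0)"
    using cong[OF s0(1)] by (rule dvd_add)
  then have "Q dvd z - (f' s0 + r)"
    by (simp add: algebra_simps)
  moreover have "z < f s \<longleftrightarrow> f' s0 + r < f' s" if "s \<in> T" for s
  proof (cases "z < f s")
    case True
    then show ?thesis using gaps[OF s0(1) that r(1,2)] r by linarith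
  next
    case False
    then show ?thesis
      using gaps[OF s0(1) that order.refl] \<open>Q > 0\<close> max0[OF that] r by linarith
  qed
  ultimately show thesis by (rule that)
next
  case False
  then have above: "\<And>s. s \<in> T \<Longrightarrow> z < f s" by force
  obtain s1 where s1: "s1 \<in> T"
    and least: "\<And>s. s \<in> T \<Longrightarrow> nat (f s1 - z) \<le> nat (f s - z)"
    using ex_has_least_nat[of "\<lambda>s. s \<in> T" _ "\<lambda>s. nat (f s - z)"] \<open>T \<noteq> {}\<close> by blast
  have min1: "f s1 \<le> f s" if "s \<in> T" for s
    using least[OF that] above[OF that] by linarith
  \<comment> \<open>The offset 1 keeps \<open>z' = f' s1 - 1 - r\<close> strictly below
    \<open>f' s1\<close> even when the remainder is 0.\<close>
  define r where "r = (f s1 - z - 1) mod Q"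
  have r: "0 \<le> r" using \<open>Q > 0\<close> unfolding r_def by simp
  have "Q dvd (f s1 - z - 1) - r"
    unfolding r_def by (simp add: dvd_minus_mod)
  then have "Q dvd (f s1 - f' s1) - ((f s1 - z - 1) - r)"
    by (rule dvd_diff[OF cong[OF s1]])
  then have "Q dvd z - (f' s1 - 1 - r)"
    by (simp add: algebra_simps)
  moreover have "z < f s \<longleftrightarrow> f' s1 - 1 - r < f' s" if "s \<in> T" for s
    using gaps[OF that s1 order.refl] \<open>Q > 0\<close> min1[OF that] above[OF that] r by linarith
  ultimately show thesis by (rule that)
qed

text \<open>
  Multiplication by \<open>L = k!\<close> brings the conditions \<open>a x < v - b \<cdot> e\<close> with \<open>1 \<le> \<bar>a\<bar> \<le> k\<close> to the
  common left-hand side \<open>L x\<close>.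
\<close>

lemma similar_extend:
  assumes "i < n" "q > 0"
  obtains q' k' where "q' > 0"
    "\<And>e e' x. similar E n q' k' e e' \<Longrightarrow> \<exists>x'. similar E n q k (e(i := x)) (e'(i := x'))"
proof -
  define L where "L = (fact k :: nat)"
  \<comment> \<open>Scaling by some \<open>l \<le> L\<close> turns at most \<open>k\<close> summands
    into at most \<open>k * L\<close>; the extra one is the unit added when the coefficient of
    \<open>x\<close> is negative.\<close>
  define m where "m = k * L + 1"
  \<comment> \<open>A point congruent to \<open>int L * x\<close> modulo \<open>Q\<close> is
    \<open>int L\<close> times a point congruent to \<open>x\<close> modulo \<open>q\<close>, so it
    can be divided by \<open>L\<close> again.\<close>
  define Q where "Q = int L * q"
  \<comment> \<open>Comparing the gap between two thresholds with some \<open>r \<le> Q\<close>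
    subtracts two sums of at most \<open>m\<close> summands and adds up to \<open>Q\<close>
    units.\<close>
  define k' where "k' = m + m + nat Q"
  have "L > 0" unfolding L_def by simp
  have "Q > 0" using \<open>q > 0\<close> \<open>L > 0\<close> unfolding Q_def by simp
  have "k \<le> k * L" using \<open>L > 0\<close> by simp
  then have "k \<le> m" unfolding m_def by linarith
  have "\<exists>x'. similar E n q k (e(i := x)) (e'(i := x'))" if sim: "similar E n Q k' e e'" for e e' x
  proof -
    \<comment> \<open>A pair \<open>(v, b)\<close> stands for the threshold
      \<open>v - lin n b e\<close> against which \<open>int L * x\<close> is compared;
      \<open>f e\<close> and \<open>f e'\<close> evaluate it at the two tuples.\<close>
    define T where "T = signed_sums E m \<times> {b. \<forall>j<n. \<bar>b j\<bar> \<le> int m}"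
    define f where "f e t = fst t - lin n (snd t) e" for e and t :: "int \<times> (nat \<Rightarrow> int)"
    have congr: "\<And>j. j < n \<Longrightarrow> Q dvd e j - e' j"
      and cuts: "\<And>a v. (\<forall>j<n. \<bar>a j\<bar> \<le> int k') \<Longrightarrow> v \<in> signed_sums E k' \<Longrightarrow>
        (lin n a e < v \<longleftrightarrow> lin n a e' < v)"
      using sim unfolding similar_def by blast+
    have "(0, \<lambda>_. 0) \<in> T"
      unfolding T_def by (simp add: zero_in_signed_sums)
    then have "T \<noteq> {}" by blast
    have cong_f: "Q dvd f e s - f e' s" for s
      using dvd_lin_diff[OF congr, where a = "snd s"] unfolding f_def
      by (simp add: dvd_diff_commute)
    have gaps_f: "f e t - f e s \<le> r \<longleftrightarrow> f e' t - f e' s \<le> r"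
      if "s \<in> T" "t \<in> T" "0 \<le> r" "r \<le> Q" for s t r
    proof -
      obtain v b w c where st: "s = (v, b)" "t = (w, c)" by (cases s, cases t)
      have "w + (- v) + (- int (nat r)) \<in> signed_sums E (m + m + nat r)"
        using that(1,2) unfolding st T_def
        by (intro signed_sums_add signed_sums_uminus nat_in_signed_sums) auto
      moreover have "m + m + nat r \<le> k'"
        using that(4) unfolding k'_def by simp
      ultimately have "w - v - r \<in> signed_sums E k'"
        using signed_sums_mono that(3) by fastforce
      moreover have "\<bar>c j - b j\<bar> \<le> int k'" if "j < n" for j
      proof -
        have "\<bar>b j\<bar> \<le> int m" "\<bar>c j\<bar> \<le> int m"
          using \<open>s \<in> T\<close> \<open>t \<in> T\<close> \<open>j < n\<close> unfolding st T_def by auto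
        then show ?thesis unfolding k'_def by linarith
      qed
      ultimately have "lin n (\<lambda>j. c j - b j) e < w - v - r \<longleftrightarrow> lin n (\<lambda>j. c j - b j) e' < w - v - r"
        by (intro cuts) auto
      then show ?thesis
        unfolding st f_def lin_diff by auto
    qed
    obtain z' where z': "Q dvd int L * x - z'"
      and cut: "\<And>s. s \<in> T \<Longrightarrow> int L * x < f e s \<longleftrightarrow> z' < f e' s"
      by (rule transfer_cut[OF \<open>Q > 0\<close> \<open>T \<noteq> {}\<close>, of "f e" "f e'" "int L * x"])
        (use cong_f gaps_f in blast)+
    obtain y where y: "int L * x - z' = Q * y" using z' by (rule dvdE)
    define x' where "x' = x - q * y"
    have z'_eq: "z' = int L * x'"
      using y unfolding x'_def Q_def by (simp add: algebra_simps)
    have "q dvd x - x'" unfolding x'_def by simp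
    have "similar E n q k (e(i := x)) (e'(i := x'))"
      unfolding similar_def
    proof (intro conjI allI impI)
      fix j assume "j < n"
      have "q dvd Q" unfolding Q_def by simp
      then show "q dvd (e(i := x)) j - (e'(i := x')) j"
        using congr[OF \<open>j < n\<close>] \<open>q dvd x - x'\<close> dvd_trans by auto
    next
      fix a v
      assume a: "\<forall>j<n. \<bar>a j\<bar> \<le> int k" and v: "v \<in> signed_sums E k"
      define b where "b = a(i := 0)"
      have b: "\<bar>b j\<bar> \<le> int k" if "j < n" for j
        using a that unfolding b_def by auto
      have main: "a i * x + lin n b e < v \<longleftrightarrow> a i * x' + lin n b e' < v"
      proof (cases "a i = 0")
        case True
        have "k \<le> k'" using \<open>k \<le> m\<close> unfolding k'_def by simp
        then have "v \<in> signed_sums E k'" "\<forall>j<n. \<bar>b j\<bar> \<le> int k'"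
          using v b signed_sums_mono by fastforce+
        then show ?thesis using cuts True by simp
      next
        case False
        define p where "p = nat \<bar>a i\<bar>"
        have p: "1 \<le> p" "p \<le> k" "\<bar>a i\<bar> = int p"
          using False a \<open>i < n\<close> unfolding p_def by auto
        then have "p dvd L" unfolding L_def by (simp add: dvd_fact)
        then obtain l where l: "L = p * l" by (rule dvdE)
        have "l > 0" using l \<open>L > 0\<close> by (cases l) auto
        have "l \<le> L" using l p(1) by simp
        have "l * k \<le> k * L" using \<open>l \<le> L\<close> by (simp add: mult.commute)
        have lv: "int l * v \<in> signed_sums E (k * L)"
          using signed_sums_scale_nat[OF v, of l] \<open>l * k \<le> k * L\<close> signed_sums_mono by blast
        have lb: "\<bar>int l * b j\<bar> \<le> int (k * L)" if "j < n" for j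
        proof -
          have "\<bar>int l * b j\<bar> \<le> int l * int k"
            using b[OF that] by (simp add: abs_mult mult_left_mono)
          also have "\<dots> \<le> int (k * L)"
            using \<open>l * k \<le> k * L\<close> by (metis of_nat_le_iff of_nat_mult)
          finally show ?thesis .
        qed
        show ?thesis
        proof (cases "a i > 0")
          case True
          have "int l * v \<in> signed_sums E m"
            using lv signed_sums_mono[of "k * L" m E] unfolding m_def by auto
          then have inT: "(int l * v, \<lambda>j. int l * b j) \<in> T"
            using lb unfolding T_def m_def by fastforce
          have "a i * u + g < v \<longleftrightarrow> int L * u < int l * v - int l * g" for u g
          proof -
            have "int L * u < int l * v - int l * g \<longleftrightarrow> int l * (a i * u + g) < int l * v"
              using True p(3) by (simp add: l algebra_simps)
            then show ?thesis using \<open>l > 0\<close> by simp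
          qed
          then show ?thesis
            using cut[OF inT] unfolding f_def z'_eq by (simp add: lin_scale)
        next
          case False
          \<comment> \<open>Dividing out a negative coefficient reverses the inequality, giving a
            lower bound on \<open>int L * u\<close>. Adding 1 rewrites it as the negation of a
            strict upper bound, the shape that \<open>cut\<close> handles.\<close>
          have "- (int l * v) + 1 \<in> signed_sums E (k * L + 1)"
            by (intro signed_sums_add signed_sums_uminus lv signed_sums_1I) auto
          then have inT: "(- (int l * v) + 1, \<lambda>j. - int l * b j) \<in> T"
            using lb unfolding T_def m_def by fastforce
          have "a i * u + g < v \<longleftrightarrow> \<not> int L * u < - (int l * v) + 1 - (- int l * g)" for u g
          proof -
            have "a i = - int p" using False p(3) by simp
            then have "int l * (a i * u + g) < int l * v
                \<longleftrightarrow> \<not> int L * u < - (int l * v) + 1 - (- int l * g)"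
              by (auto simp: l algebra_simps)
            then show ?thesis using \<open>l > 0\<close> by simp
          qed
          then show ?thesis
            using cut[OF inT] unfolding f_def z'_eq fst_conv snd_conv lin_scale by simp
        qed
      qed
      then show "lin n a (e(i := x)) < v \<longleftrightarrow> lin n a (e'(i := x')) < v"
        unfolding lin_fun_upd[OF \<open>i < n\<close>] b_def .
    qed
    then show ?thesis by blast
  qed
  then show thesis using that \<open>Q > 0\<close> by blast
qed

section \<open>Invariance of formulas under similarity\<close>

lemma tm_val_eq_lin: "\<exists>a K n0. (\<forall>j. \<bar>a j\<bar> \<le> int K) \<and> (\<forall>n\<ge>n0. \<forall>e. tm_val e t = lin n a e)"
proof (induction t)
  case (Var i)
  have "tm_val e (Var i) = lin n (\<lambda>j. if j = i then 1 else 0) e" if "n \<ge> Suc i" for n e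
  proof -
    have "lin n (\<lambda>j. if j = i then 1 else 0) e = (\<Sum>j<n. if j = i then e j else 0)"
      unfolding lin_def by (rule sum.cong) auto
    then show ?thesis using that by simp
  qed
  then show ?case
    by (intro exI[of _ "\<lambda>j. if j = i then 1 else 0"] exI[of _ 1] exI[of _ "Suc i"]) auto
next
  case (Plus s t)
  then obtain a K n0 b K' n0' where
    s: "\<And>j. \<bar>a j\<bar> \<le> int K" "\<And>n e. n \<ge> n0 \<Longrightarrow> tm_val e s = lin n a e" and
    t: "\<And>j. \<bar>b j\<bar> \<le> int K'" "\<And>n e. n \<ge> n0' \<Longrightarrow> tm_val e t = lin n b e"
    by metis
  have "\<bar>a j + b j\<bar> \<le> int (K + K')" for j
    using s(1)[of j] t(1)[of j] by simp
  moreover have "tm_val e (Plus s t) = lin n (\<lambda>j. a j + b j) e" if "n \<ge> max n0 n0'" for n e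
    using s(2)[of n e] t(2)[of n e] that by (simp add: lin_add)
  ultimately show ?case by (intro exI[of _ "\<lambda>j. a j + b j"]) blast
qed

text \<open>Comparing two terms amounts to cutting one linear form, the difference of theirs, once
  \<open>k\<close> dominates its coefficients. Modulus 1 suffices for atomic formulas; larger moduli
  come from quantifiers.\<close>

lemma similar_tm_diff:
  "\<exists>n0 K. \<forall>n\<ge>n0. \<forall>k\<ge>K. \<forall>e e' v. similar E n 1 k e e' \<longrightarrow> v \<in> signed_sums E k \<longrightarrow>
     (tm_val e s - tm_val e t < v \<longleftrightarrow> tm_val e' s - tm_val e' t < v)"
proof -
  obtain a K n0 b K' n0' where
    s: "\<And>j. \<bar>a j\<bar> \<le> int K" "\<And>n e. n \<ge> n0 \<Longrightarrow> tm_val e s = lin n a e" and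
    t: "\<And>j. \<bar>b j\<bar> \<le> int K'" "\<And>n e. n \<ge> n0' \<Longrightarrow> tm_val e t = lin n b e"
    using tm_val_eq_lin[of s] tm_val_eq_lin[of t] by metis
  have "tm_val e s - tm_val e t < v \<longleftrightarrow> tm_val e' s - tm_val e' t < v"
    if "n \<ge> max n0 n0'" "k \<ge> K + K'" "similar E n 1 k e e'" "v \<in> signed_sums E k" for n k e e' v
  proof -
    have "\<bar>a j - b j\<bar> \<le> int k" for j
      using s(1)[of j] t(1)[of j] that(2) by simp
    then have "lin n (\<lambda>j. a j - b j) e < v \<longleftrightarrow> lin n (\<lambda>j. a j - b j) e' < v"
      using that(3,4) unfolding similar_def by (auto dest: spec[of _ "\<lambda>j. a j - b j"])
    then show ?thesis
      using s(2)[of n e] t(2)[of n e] s(2)[of n e'] t(2)[of n e'] that(1) by (simp add: lin_diff)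
  qed
  then show ?thesis by blast
qed

text \<open>A value \<open>w\<close> in \<open>E\<close> makes both \<open>w\<close> and
  \<open>w + 1\<close> thresholds, and these two cuts pin the value at the other tuple to
  \<open>w\<close>. Since the values themselves agree, every relation on \<open>E\<close> is
  preserved, however complicated.\<close>

lemma similar_tm_in_E:
  "\<exists>n0 K. \<forall>n\<ge>n0. \<forall>k\<ge>K. \<forall>e e'. similar E n 1 k e e' \<longrightarrow> tm_val e t \<in> E \<longrightarrow> tm_val e' t = tm_val e t"
proof -
  obtain a K n0 where
    t: "\<And>j. \<bar>a j\<bar> \<le> int K" "\<And>n e. n \<ge> n0 \<Longrightarrow> tm_val e t = lin n a e"
    using tm_val_eq_lin[of t] by metis
  have "tm_val e' t = tm_val e t"
    if n: "n \<ge> n0" and k: "k \<ge> K + 2" and "similar E n 1 k e e'" and E: "tm_val e t \<in> E" for n k e e'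
  proof -
    have "\<bar>a j\<bar> \<le> int k" for j
      using t(1)[of j] k by simp
    then have cut: "tm_val e t < v \<longleftrightarrow> tm_val e' t < v" if "v \<in> signed_sums E k" for v
      using that \<open>similar E n 1 k e e'\<close> unfolding similar_def t(2)[OF n] by blast
    have *: "tm_val e t \<in> signed_sums E 1" "tm_val e t + 1 \<in> signed_sums E (1 + 1)"
      using E by (intro signed_sums_add signed_sums_1I; simp)+
    have "signed_sums E 1 \<subseteq> signed_sums E k" "signed_sums E (1 + 1) \<subseteq> signed_sums E k"
      using k by (intro signed_sums_mono; simp)+
    with * have "tm_val e t \<in> signed_sums E k" "tm_val e t + 1 \<in> signed_sums E k"
      by blast+
    from this[THEN cut] show ?thesis by linarith
  qed
  then show ?thesis by blast
qed

lemma similar_tms_in_E: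
  "\<exists>n0 K. \<forall>n\<ge>n0. \<forall>k\<ge>K. \<forall>e e'. similar E n 1 k e e' \<longrightarrow> set (map (tm_val e) ts) \<subseteq> E \<longrightarrow>
     map (tm_val e') ts = map (tm_val e) ts"
proof (induction ts)
  case Nil
  then show ?case by simp
next
  case (Cons t ts)
  then obtain n0 K where ts: "\<And>n k e e'. n \<ge> n0 \<Longrightarrow> k \<ge> K \<Longrightarrow> similar E n 1 k e e' \<Longrightarrow>
      set (map (tm_val e) ts) \<subseteq> E \<Longrightarrow> map (tm_val e') ts = map (tm_val e) ts"
    by blast
  obtain n0' K' where t: "\<And>n k e e'. n \<ge> n0' \<Longrightarrow> k \<ge> K' \<Longrightarrow> similar E n 1 k e e' \<Longrightarrow>
      tm_val e t \<in> E \<Longrightarrow> tm_val e' t = tm_val e t"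
    using similar_tm_in_E[of E t] by blast
  have "map (tm_val e') (t # ts) = map (tm_val e) (t # ts)"
    if "n \<ge> max n0 n0'" "k \<ge> max K K'" "similar E n 1 k e e'" "set (map (tm_val e) (t # ts)) \<subseteq> E"
    for n k e e'
    using ts[OF _ _ that(3)] t[OF _ _ that(3)] that by simp
  then show ?case by blast
qed

text \<open>Induction on the formula. Having the claim for all large \<open>n\<close> lets the two
  halves of a conjunction share one \<open>n\<close>, and in the case of \<open>Exi i\<close> allows
  \<open>n > i\<close>, so that \<open>similar_extend\<close> applies to the bound variable.
  Symmetry of similarity reduces predicates and quantifiers to one implication.\<close>

lemma sat_similar:
  "in_language (sharp E) p \<Longrightarrow>
     \<exists>n0. \<forall>n\<ge>n0. \<exists>q>0. \<exists>k. \<forall>e e'. similar E n q k e e' \<longrightarrow> (sat e p \<longleftrightarrow> sat e' p)"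
proof (induction p)
  case (Equal s t)
  obtain n0 K where cut: "\<And>n k e e' v. n \<ge> n0 \<Longrightarrow> k \<ge> K \<Longrightarrow> similar E n 1 k e e' \<Longrightarrow>
      v \<in> signed_sums E k \<Longrightarrow>
      (tm_val e s - tm_val e t < v \<longleftrightarrow> tm_val e' s - tm_val e' t < v)"
    using similar_tm_diff[of E s t] by blast
  have "sat e (Equal s t) \<longleftrightarrow> sat e' (Equal s t)" if "n \<ge> n0" "similar E n 1 (K + 1) e e'" for n e e'
  proof -
    \<comment> \<open>Equality of the terms means that their difference is below 1 but not below 0.
      The level \<open>K + 1\<close> makes 1 a threshold even when \<open>K = 0\<close>.\<close>
    have "1 \<in> signed_sums E (K + 1)"
      using signed_sums_add[OF zero_in_signed_sums[of E K] signed_sums_1I[of 1 E]] by simp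
    then show ?thesis
      using cut[OF that(1) _ that(2), of 1] cut[OF that(1) _ that(2) zero_in_signed_sums] by force
  qed
  then show ?case using zero_less_one by blast
next
  case (Less s t)
  obtain n0 K where cut: "\<And>n k e e' v. n \<ge> n0 \<Longrightarrow> k \<ge> K \<Longrightarrow> similar E n 1 k e e' \<Longrightarrow>
      v \<in> signed_sums E k \<Longrightarrow>
      (tm_val e s - tm_val e t < v \<longleftrightarrow> tm_val e' s - tm_val e' t < v)"
    using similar_tm_diff[of E s t] by blast
  have "sat e (Less s t) \<longleftrightarrow> sat e' (Less s t)" if "n \<ge> n0" "similar E n 1 K e e'" for n e e'
    using cut[OF that(1) order.refl that(2) zero_in_signed_sums] by simp
  then show ?case using zero_less_one by blast
next
  case (Pred l S ts)
  then have S: "set us \<subseteq> E" if "us \<in> S" for us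
    using that by (auto simp: sharp_def tuples_def)
  obtain n0 K where ts: "\<And>n k e e'. n \<ge> n0 \<Longrightarrow> k \<ge> K \<Longrightarrow> similar E n 1 k e e' \<Longrightarrow>
      set (map (tm_val e) ts) \<subseteq> E \<Longrightarrow> map (tm_val e') ts = map (tm_val e) ts"
    using similar_tms_in_E[of E ts] by blast
  have imp: "sat e (Pred l S ts) \<Longrightarrow> sat e' (Pred l S ts)" if "n \<ge> n0" "similar E n 1 K e e'" for n e e'
    using ts[OF that(1) order.refl that(2)] S[of "map (tm_val e) ts"] by (metis sat.simps(3))
  have "sat e (Pred l S ts) \<longleftrightarrow> sat e' (Pred l S ts)" if "n \<ge> n0" "similar E n 1 K e e'" for n e e'
    using imp[OF that] imp[OF that(1) similar_sym[OF that(2)]] by blast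
  then show ?case using zero_less_one by blast
next
  case (Neg p)
  then show ?case by simp
next
  case (Conj p r)
  then obtain n1 n2 where
    1: "\<And>n. n \<ge> n1 \<Longrightarrow> \<exists>q>0. \<exists>k. \<forall>e e'. similar E n q k e e' \<longrightarrow> (sat e p \<longleftrightarrow> sat e' p)" and
    2: "\<And>n. n \<ge> n2 \<Longrightarrow> \<exists>q>0. \<exists>k. \<forall>e e'. similar E n q k e e' \<longrightarrow> (sat e r \<longleftrightarrow> sat e' r)"
    by (metis in_language.simps(5))
  have "\<exists>q>0. \<exists>k. \<forall>e e'. similar E n q k e e' \<longrightarrow> (sat e (Conj p r) \<longleftrightarrow> sat e' (Conj p r))"
    if n: "n \<ge> max n1 n2" for n
  proof -
    from n 1 obtain q1 k1 where
      1: "q1 > 0" "\<And>e e'. similar E n q1 k1 e e' \<Longrightarrow> (sat e p \<longleftrightarrow> sat e' p)" by (metis max.bounded_iff)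
    from n 2 obtain q2 k2 where
      2: "q2 > 0" "\<And>e e'. similar E n q2 k2 e e' \<Longrightarrow> (sat e r \<longleftrightarrow> sat e' r)" by (metis max.bounded_iff)
    have "sat e (Conj p r) \<longleftrightarrow> sat e' (Conj p r)" if "similar E n (q1 * q2) (max k1 k2) e e'" for e e'
      using 1(2)[OF similar_mono[OF that]] 2(2)[OF similar_mono[OF that]] by simp
    then show ?thesis using 1(1) 2(1) by (intro exI[of _ "q1 * q2"]) auto
  qed
  then show ?case by blast
next
  case (Exi i p)
  then obtain n0 where
    IH: "\<And>n. n \<ge> n0 \<Longrightarrow> \<exists>q>0. \<exists>k. \<forall>e e'. similar E n q k e e' \<longrightarrow> (sat e p \<longleftrightarrow> sat e' p)"
    by auto
  have "\<exists>q>0. \<exists>k. \<forall>e e'. similar E n q k e e' \<longrightarrow> (sat e (Exi i p) \<longleftrightarrow> sat e' (Exi i p))"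
    if n: "n \<ge> max n0 (Suc i)" for n
  proof -
    from n IH obtain q k where
      q: "q > 0" "\<And>e e'. similar E n q k e e' \<Longrightarrow> (sat e p \<longleftrightarrow> sat e' p)" by (metis max.bounded_iff)
    have "i < n" using n by simp
    then obtain q' k' where q': "q' > 0"
      "\<And>e e' x. similar E n q' k' e e' \<Longrightarrow> \<exists>x'. similar E n q k (e(i := x)) (e'(i := x'))"
      using similar_extend[OF _ q(1)] by metis
    have imp: "sat e (Exi i p) \<Longrightarrow> sat e' (Exi i p)" if "similar E n q' k' e e'" for e e'
      using q'(2)[OF that] q(2) by (metis sat.simps(6))
    have "sat e (Exi i p) \<longleftrightarrow> sat e' (Exi i p)" if "similar E n q' k' e e'" for e e'
      using imp[OF that] imp[OF similar_sym[OF that]] by blast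
    then show ?thesis using q'(1) by blast
  qed
  then show ?case by blast
qed

section \<open>Points near thresholds\<close>

lemma ex_tm_multiple: "\<exists>t'. \<forall>e. tm_val e t' = tm_val e t + int c * e i"
proof (induction c)
  case 0
  show ?case by (intro exI[of _ t]) simp
next
  case (Suc c)
  then obtain t' where "\<And>e. tm_val e t' = tm_val e t + int c * e i" by blast
  then show ?case by (intro exI[of _ "Plus t' (Var i)"]) (simp add: algebra_simps)
qed

text \<open>Terms have neither subtraction nor constants, so the positive coefficients are collected
  in \<open>s\<close> and the negated negative ones in \<open>t\<close>.\<close>

lemma ex_tms_diff_eq_lin: "\<exists>s t. \<forall>e. tm_val e s - tm_val e t = lin n a e"
proof (induction n)
  case 0
  show ?case by (simp add: lin_def) blast
next
  case (Suc n)
  then obtain s t where st: "\<And>e. tm_val e s - tm_val e t = lin n a e" by blast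
  obtain s' where s': "\<And>e. tm_val e s' = tm_val e s + int (nat (a n)) * e n"
    using ex_tm_multiple by blast
  obtain t' where t': "\<And>e. tm_val e t' = tm_val e t + int (nat (- a n)) * e n"
    using ex_tm_multiple by blast
  have "tm_val e s' - tm_val e t' = lin (Suc n) a e" for e
  proof -
    have "lin (Suc n) a e = lin n a e + (int (nat (a n)) - int (nat (- a n))) * e n"
      by (simp add: lin_def)
    then show ?thesis
      using st[of e] by (simp only: s' t' left_diff_distrib)
  qed
  then show ?case by blast
qed

text \<open>The quotient is the unique \<open>y\<close> whose remainder, dividend minus
  \<open>a * y\<close>, lies in \<open>[0, a)\<close>. These are the functions through which the
  hypothesis on images of powers of \<open>E\<close> is applied.\<close>

lemma presburger_definable_fun_linear_div:
  fixes a d :: int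
  assumes "a > 0"
  shows "presburger_definable_fun M (\<lambda>us. (lin M b (\<lambda>i. us ! i) + d) div a)"
proof -
  \<comment> \<open>Variables below \<open>M\<close> hold the arguments and variable
    \<open>M\<close> the value \<open>y\<close>; variables \<open>M + 1\<close> and
    \<open>M + 2\<close> hold the parameters \<open>d\<close> and \<open>a\<close>.\<close>
  define coef where "coef j = (if j < M then b j else if j = M then - a else 1)" for j
  define par where "par i = (if i = Suc M then d else a)" for i
  obtain s t where st: "\<And>e. tm_val e s - tm_val e t = lin (M + 2) coef e"
    using ex_tms_diff_eq_lin by blast
  define p where "p = Conj (Neg (Less s t)) (Less s (Plus t (Var (M + 2))))"
  define h where "h us = (lin M b (\<lambda>i. us ! i) + d) div a" for us
  have sat_p: "sat (\<lambda>i. if i < Suc M then (us @ [y]) ! i else par i) p \<longleftrightarrow> y = h us"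
    if "length us = M" for us y
  proof -
    let ?e = "\<lambda>i. if i < Suc M then (us @ [y]) ! i else par i"
    have "(\<Sum>j<M. coef j * ?e j) = lin M b (\<lambda>i. us ! i)"
      unfolding lin_def using that by (intro sum.cong) (auto simp: coef_def nth_append)
    then have "lin (M + 2) coef ?e = lin M b (\<lambda>i. us ! i) - a * y + d"
      using that by (simp add: lin_def coef_def par_def nth_append)
    then have "tm_val ?e s - tm_val ?e t = (lin M b (\<lambda>i. us ! i) + d) - a * y"
      using st[of ?e] by simp
    then have "sat ?e p \<longleftrightarrow>
        0 \<le> (lin M b (\<lambda>i. us ! i) + d) - a * y \<and> (lin M b (\<lambda>i. us ! i) + d) - a * y < a"
      by (auto simp: p_def par_def)
    also have "\<dots> \<longleftrightarrow> y = h us"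
    proof
      assume "0 \<le> (lin M b (\<lambda>i. us ! i) + d) - a * y \<and> (lin M b (\<lambda>i. us ! i) + d) - a * y < a"
      then show "y = h us"
        unfolding h_def
        by (intro int_div_pos_eq[symmetric, where r = "(lin M b (\<lambda>i. us ! i) + d) - a * y"]) auto
    next
      assume "y = h us"
      then show "0 \<le> (lin M b (\<lambda>i. us ! i) + d) - a * y \<and> (lin M b (\<lambda>i. us ! i) + d) - a * y < a"
        using \<open>a > 0\<close> by (simp add: h_def minus_mult_div_eq_mod)
    qed
    finally show ?thesis .
  qed
  have "{us @ [h us] | us. us \<in> tuples UNIV M} =
      {xs \<in> tuples UNIV (Suc M). sat (\<lambda>i. if i < Suc M then xs ! i else par i) p}" (is "?A = ?B")
  proof
    show "?A \<subseteq> ?B" using sat_p by (auto simp: tuples_def)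
    show "?B \<subseteq> ?A"
    proof
      fix xs assume xs: "xs \<in> ?B"
      then have "length xs = Suc M" by (simp add: tuples_def)
      then obtain us y where "xs = us @ [y]" "length us = M"
        by (metis length_Suc_conv_rev)
      then show "xs \<in> ?A" using xs sat_p by (auto simp: tuples_def)
    qed
  qed
  moreover have "in_language {} p" by (simp add: p_def)
  ultimately show ?thesis
    unfolding presburger_definable_fun_def definable_def h_def by blast
qed

section \<open>Ideals and neighbourhoods of thresholds\<close>

lemma set_ideal_subset: "set_ideal \<I> \<Longrightarrow> A \<in> \<I> \<Longrightarrow> B \<subseteq> A \<Longrightarrow> B \<in> \<I>"
  unfolding set_ideal_def by blast

lemma set_ideal_Un: "set_ideal \<I> \<Longrightarrow> A \<in> \<I> \<Longrightarrow> B \<in> \<I> \<Longrightarrow> A \<union> B \<in> \<I>"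
  unfolding set_ideal_def by blast

lemma set_ideal_finite_UN:
  assumes "set_ideal \<I>" "finite J" "\<And>j. j \<in> J \<Longrightarrow> A j \<in> \<I>"
  shows "(\<Union>j\<in>J. A j) \<in> \<I>"
  using assms(2,3)
proof (induction J)
  case empty
  then show ?case using assms(1) unfolding set_ideal_def by auto
next
  case (insert j J)
  then show ?case using set_ideal_Un[OF assms(1)] by simp
qed

text \<open>The summands of \<open>v\<close> are moved one by one into the linear form: a unit is
  absorbed by \<open>d\<close>, an element of \<open>E\<close> or its negative becomes a new
  argument with coefficient 1 or -1. Hence the induction on \<open>k\<close> runs over all
  \<open>M\<close>, \<open>b\<close> and \<open>d\<close>, and ends with the image of a power of
  \<open>E\<close> under a definable function.\<close>

lemma signed_sums_div_in_ideal:
  fixes a d :: int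
  assumes "set_ideal \<I>"
    and pres: "\<And>(M::nat) h. presburger_definable_fun M h \<Longrightarrow> h ` tuples E M \<in> \<I>"
    and "a > 0"
  shows "{(v + lin M b (\<lambda>i. us ! i) + d) div a | v us. v \<in> signed_sums E k \<and> us \<in> tuples E M} \<in> \<I>"
    (is "?S k M b d \<in> \<I>")
proof (induction k arbitrary: M b d)
  case 0
  have "?S 0 M b d \<subseteq> (\<lambda>us. (lin M b (\<lambda>i. us ! i) + d) div a) ` tuples E M"
    by (auto simp: signed_sums_def)
  then show ?case
    using set_ideal_subset[OF assms(1) pres[OF presburger_definable_fun_linear_div[OF \<open>a > 0\<close>]]]
    by blast
next
  case (Suc k)
  let ?R = "?S k M b d \<union> (?S k M b (d + 1) \<union> (?S k M b (d - 1) \<union>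
    (?S k (Suc M) (b(M := 1)) d \<union> ?S k (Suc M) (b(M := -1)) d)))"
  have lin_snoc: "lin (Suc M) (b(M := c)) (\<lambda>i. (us @ [w]) ! i) = lin M b (\<lambda>i. us ! i) + c * w"
    if "us \<in> tuples E M" for us c w
    using that by (auto simp: lin_def tuples_def nth_append intro!: sum.cong)
  have "?S (Suc k) M b d \<subseteq> ?R"
  proof
    fix x assume "x \<in> ?S (Suc k) M b d"
    then obtain v us where x: "x = (v + lin M b (\<lambda>i. us ! i) + d) div a"
      and v: "v \<in> signed_sums E (Suc k)" and us: "us \<in> tuples E M" by blast
    from v show "x \<in> ?R"
    proof (cases rule: signed_sums_Suc)
      case 1
      then show ?thesis using x us by blast
    next
      case (2 w v')
      have tup: "us @ [u] \<in> tuples E (Suc M)" if "u \<in> E" for u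
        using us that by (simp add: tuples_def)
      from 2(1) consider "w = 1" | "w = -1" | "w \<in> E" | u where "u \<in> E" "w = - u" by blast
      then show ?thesis
      proof cases
        case 1
        then have "x = (v' + lin M b (\<lambda>i. us ! i) + (d + 1)) div a"
          using x 2(3) by (simp add: algebra_simps)
        then show ?thesis using us 2(2) by blast
      next
        case 2
        then have "x = (v' + lin M b (\<lambda>i. us ! i) + (d - 1)) div a"
          using x \<open>v = v' + w\<close> by (simp add: algebra_simps)
        then show ?thesis using us \<open>v' \<in> signed_sums E k\<close> by blast
      next
        case 3
        then have "x = (v' + lin (Suc M) (b(M := 1)) (\<lambda>i. (us @ [w]) ! i) + d) div a"
          unfolding lin_snoc[OF us] using x 2(3) by (simp add: algebra_simps)
        then show ?thesis using tup[OF 3] 2(2) by blast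
      next
        case 4
        then have "x = (v' + lin (Suc M) (b(M := -1)) (\<lambda>i. (us @ [u]) ! i) + d) div a"
          unfolding lin_snoc[OF us] using x 2(3) by (simp add: algebra_simps)
        then show ?thesis using tup[OF 4(1)] 2(2) by blast
      qed
    qed
  qed
  moreover have "?R \<in> \<I>"
    by (intro set_ideal_Un[OF assms(1)] Suc.IH)
  ultimately show ?case
    by (rule set_ideal_subset[OF assms(1), rotated])
qed

text \<open>If \<open>a * x - d = v\<close>, then \<open>x\<close> is the exact quotient of
  \<open>v + d\<close> by \<open>a\<close>. Only finitely many pairs \<open>(a, d)\<close> occur, so
  a finite union suffices.\<close>

lemma near_signed_sums_in_ideal:
  fixes D :: int
  assumes "set_ideal \<I>"
    and "\<And>(M::nat) h. presburger_definable_fun M h \<Longrightarrow> h ` tuples E M \<in> \<I>"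
  shows "{x. \<exists>a d. 1 \<le> a \<and> a \<le> K \<and> \<bar>d\<bar> \<le> D \<and> a * x - d \<in> signed_sums E k} \<in> \<I>"
proof -
  have single: "{x. a * x - d \<in> signed_sums E k} \<in> \<I>" if "a > 0" for a d
  proof -
    have "{x. a * x - d \<in> signed_sums E k} \<subseteq>
      {(v + lin 0 (\<lambda>_. 0) (\<lambda>i. us ! i) + d) div a | v us. v \<in> signed_sums E k \<and> us \<in> tuples E 0}"
    proof
      fix x assume "x \<in> {x. a * x - d \<in> signed_sums E k}"
      moreover have "x = ((a * x - d) + lin 0 (\<lambda>_. 0) (\<lambda>i. [] ! i) + d) div a"
        using that by (simp add: lin_def)
      moreover have "[] \<in> tuples E 0" by (simp add: tuples_def)
      ultimately show "x \<in> {(v + lin 0 (\<lambda>_. 0) (\<lambda>i. us ! i) + d) div a | v us.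
          v \<in> signed_sums E k \<and> us \<in> tuples E 0}" by blast
    qed
    then show ?thesis
      using set_ideal_subset[OF assms(1) signed_sums_div_in_ideal[OF assms that]] by blast
  qed
  have "{x. \<exists>a d. 1 \<le> a \<and> a \<le> K \<and> \<bar>d\<bar> \<le> D \<and> a * x - d \<in> signed_sums E k} =
      (\<Union>(a, d) \<in> {1..K} \<times> {- D..D}. {x. a * x - d \<in> signed_sums E k})"
    by (auto simp: abs_le_iff; force)
  also have "\<dots> \<in> \<I>"
    using single by (intro set_ideal_finite_UN[OF assms(1)]) auto
  finally show ?thesis .
qed

text \<open>A form that told \<open>x\<close> and \<open>x + y\<close> apart would have a threshold
  between its two values, hence within \<open>D\<close> of a multiple of \<open>x\<close>. The bound
  \<open>D\<close> covers both the contribution of the parameters \<open>c\<close> and the effect of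
  the shift \<open>y\<close>.\<close>

lemma similar_translate:
  fixes c :: "nat \<Rightarrow> int"
  assumes "n > 0" "0 \<le> y" "q dvd y"
    and "int k * (\<Sum>j<n. \<bar>c j\<bar>) + int k * y \<le> D"
    and far: "\<And>a d. 1 \<le> a \<Longrightarrow> a \<le> int k \<Longrightarrow> \<bar>d\<bar> \<le> D \<Longrightarrow> a * x - d \<notin> signed_sums E k"
  shows "similar E n q k (c(0 := x)) (c(0 := x + y))"
  unfolding similar_def
proof (intro conjI allI impI)
  fix j show "q dvd (c(0 := x)) j - (c(0 := x + y)) j"
    using \<open>q dvd y\<close> by simp
next
  fix a v assume a: "\<forall>j<n. \<bar>a j\<bar> \<le> int k" and v: "v \<in> signed_sums E k"
  define d where "d = lin n (a(0 := 0)) c"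
  have d: "\<bar>d\<bar> \<le> int k * (\<Sum>j<n. \<bar>c j\<bar>)"
    unfolding d_def using a by (intro abs_lin_le) auto
  have a0: "\<bar>a 0\<bar> \<le> int k" using a \<open>n > 0\<close> by blast
  have "\<bar>a 0 * y\<bar> \<le> int k * y"
    using a0 \<open>0 \<le> y\<close> by (simp add: abs_mult mult_right_mono)
  with d assms(4) have ady: "\<bar>d\<bar> + \<bar>a 0 * y\<bar> \<le> D" by linarith
  have "a 0 * x + d < v \<longleftrightarrow> a 0 * (x + y) + d < v"
  proof (rule ccontr)
    assume "\<not> ?thesis"
    then have diff: "a 0 \<noteq> 0" "\<bar>v - a 0 * x\<bar> \<le> \<bar>d\<bar> + \<bar>a 0 * y\<bar>"
      by (auto simp: algebra_simps)
    show False
    proof (cases "a 0 > 0")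
      case True
      have "a 0 * x - (a 0 * x - v) \<notin> signed_sums E k"
        using True a0 diff ady by (intro far) linarith+
      then show False using v by simp
    next
      case False
      \<comment> \<open>For a negative coefficient the same argument is applied to
        \<open>- a 0\<close> and the threshold \<open>- v\<close>.\<close>
      have "(- a 0) * x - (- a 0 * x + v) \<notin> signed_sums E k"
        using False a0 diff ady by (intro far) simp_all
      then show False using signed_sums_uminus[OF v] by simp
    qed
  qed
  then show "lin n a (c(0 := x)) < v \<longleftrightarrow> lin n a (c(0 := x + y)) < v"
    unfolding lin_fun_upd[OF \<open>n > 0\<close>] d_def .
qed

theorem theoremC:
  fixes \<I> :: "int set set" and E :: "int set"
  assumes "set_ideal \<I>"
    and "\<And>(M::nat) h. presburger_definable_fun M h \<Longrightarrow> h ` tuples E M \<in> \<I>"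
    and "definable_in_sharp E X"
  shows "contains_long_AP_pieces X \<or> X \<in> \<I>"
proof -
  obtain p c where p: "in_language (sharp E) p"
    and X: "(\<lambda>x. [x]) ` X = {xs \<in> tuples UNIV 1. sat (\<lambda>i. if i < 1 then xs ! i else c i) p}"
    using assms(3) unfolding definable_in_sharp_def definable_def by blast
  have X_iff: "x \<in> X \<longleftrightarrow> sat (c(0 := x)) p" for x
  proof -
    have "x \<in> X \<longleftrightarrow> [x] \<in> (\<lambda>x. [x]) ` X" by blast
    also have "\<dots> \<longleftrightarrow> sat (\<lambda>i. if i < 1 then [x] ! i else c i) p"
      unfolding X by (simp add: tuples_def)
    also have "(\<lambda>i. if i < 1 then [x] ! i else c i) = c(0 := x)" by auto
    finally show ?thesis .
  qed
  obtain n0 where "\<forall>n\<ge>n0. \<exists>q>0. \<exists>k. \<forall>e e'. similar E n q k e e' \<longrightarrow> (sat e p \<longleftrightarrow> sat e' p)"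
    using sat_similar[OF p] by blast
  \<comment> \<open>Taking \<open>Suc n0\<close> coordinates ensures that variable 0, which holds
    the point of \<open>X\<close>, is among them.\<close>
  then obtain q k where "q > 0"
    and inv: "\<And>e e'. similar E (Suc n0) q k e e' \<Longrightarrow> (sat e p \<longleftrightarrow> sat e' p)"
    using le_SucI[OF order.refl] by metis
  define near where
    "near D = {x. \<exists>a d. 1 \<le> a \<and> a \<le> int k \<and> \<bar>d\<bar> \<le> D \<and> a * x - d \<in> signed_sums E k}" for D
  show ?thesis
  proof (cases "\<exists>D. X \<subseteq> near D")
    case True
    then show ?thesis
      using set_ideal_subset[OF assms(1) near_signed_sums_in_ideal[OF assms(1,2)]]
      unfolding near_def by blast
  next
    case False
    have "\<exists>x. \<forall>i<l. x + int i * q \<in> X" for l :: nat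
    proof -
      \<comment> \<open>The distance \<open>D\<close> grows with the length \<open>l\<close> of the
        progression, but the difference \<open>q\<close> comes from the formula alone and is the
        same for every \<open>l\<close>.\<close>
      define D where "D = int k * (\<Sum>j<Suc n0. \<bar>c j\<bar>) + int k * (int l * q)"
      obtain x where x: "x \<in> X" "x \<notin> near D" using False by blast
      have "x + int i * q \<in> X" if "i < l" for i
      proof -
        have "int i * q \<le> int l * q"
          using that \<open>q > 0\<close> by simp
        then have "int k * (int i * q) \<le> int k * (int l * q)"
          by (rule mult_left_mono) simp
        then have "similar E (Suc n0) q k (c(0 := x)) (c(0 := x + int i * q))"
          using x(2) \<open>q > 0\<close> unfolding near_def
          by (intro similar_translate[where D = D]) (auto simp: D_def)
        then show ?thesis using inv x(1) X_iff by blast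
      qed
      then show ?thesis by blast
    qed
    then show ?thesis
      using \<open>q > 0\<close> unfolding contains_long_AP_pieces_def by blast
  qed
qed

end
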